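(* For every $n\ge 0$ there is a bijection $\Phi$ between the set of involutions in $S_n$ avoiding $132$ and the set of words of length $n$ in $$P_{x,\overline{x}}=\{w\in\{x,\overline{x}\}^* : |w'|_x\ge |w'|_{\overline{x}}\text{ for every factorization } w=w'w''\}.$$ Moreover, $\Phi$ can be chosen so that for every $132$-avoiding involution $\pi$ the number of fixed points of $\pi$ equals $|\Phi(\pi)|_x-|\Phi(\pi)|_{\overline{x}}$.
   Context: $S_n$ is the set of permutations of $\{1,\dots,n\}$. A permutation $\alpha\in S_n$ contains a pattern $\tau\in S_k$ if there are $1\le i_1<\dots<i_k\le n$ such that $(\alpha_{i_1},\dots,\alpha_{i_k})$ is order-isomorphic to $\tau$; otherwise $\alpha$ avoids $\tau$. An involution is a permutation $\alpha$ with $\alpha(\alpha(i))=i$ for all $i$. For a word $w$ over the two-letter alphabet $\{x,\overline{x}\}$, $|w|_x$ and $|w|_{\overline{x}}$ denote the numbers of occurrences of the letters $x$ and $\overline{x}$ in $w$. The words in $P_{x,\overline{x}}$ are called primitive Dyck words in the paper. *)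

theory Defs
  imports "HOL-Combinatorics.Combinatorics"
begin

(* A permutation in S_n is a function p with p permutes {1..n}; it is the
   identity outside {1..n}, so each element of S_n is represented exactly once. *)

definition contains_pattern :: "nat \<Rightarrow> (nat \<Rightarrow> nat) \<Rightarrow> nat \<Rightarrow> (nat \<Rightarrow> nat) \<Rightarrow> bool" where
  "contains_pattern n \<alpha> k \<tau> \<longleftrightarrow>
     (\<exists>i. strict_mono_on {1..k} i \<and> i ` {1..k} \<subseteq> {1..n} \<and>
          (\<forall>a\<in>{1..k}. \<forall>b\<in>{1..k}. \<alpha> (i a) < \<alpha> (i b) \<longleftrightarrow> \<tau> a < \<tau> b))"

definition avoids_pattern :: "nat \<Rightarrow> (nat \<Rightarrow> nat) \<Rightarrow> nat \<Rightarrow> (nat \<Rightarrow> nat) \<Rightarrow> bool" where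
  "avoids_pattern n \<alpha> k \<tau> \<longleftrightarrow> \<not> contains_pattern n \<alpha> k \<tau>"

(* The element of S_3 whose one-line notation is 132: 1 is fixed, 2 and 3 are swapped. *)
definition pattern_132 :: "nat \<Rightarrow> nat" where
  "pattern_132 = transpose 2 3"

definition involutions :: "nat \<Rightarrow> (nat \<Rightarrow> nat) set" where
  "involutions n = {\<alpha>. \<alpha> permutes {1..n} \<and> (\<forall>i\<in>{1..n}. \<alpha> (\<alpha> i) = i)}"

definition involutions_avoiding_132 :: "nat \<Rightarrow> (nat \<Rightarrow> nat) set" where
  "involutions_avoiding_132 n = {\<alpha> \<in> involutions n. avoids_pattern n \<alpha> 3 pattern_132}"

definition fixed_points :: "nat \<Rightarrow> (nat \<Rightarrow> nat) \<Rightarrow> nat set" where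
  "fixed_points n \<alpha> = {i \<in> {1..n}. \<alpha> i = i}"

datatype letter = X | Xbar

definition primitive_dyck_words :: "letter list set" where
  "primitive_dyck_words =
     {w. \<forall>w' w''. w = w' @ w'' \<longrightarrow> count_list w' X \<ge> count_list w' Xbar}"

end

(* Label the letters X of a word n, n-1, ... and the letters Xbar 1, 2, ..., both from left
   to right. Matching parentheses pairs each Xbar with an X, and the involution swapping the
   labels of matched letters and fixing the labels of the unmatched ones avoids 132. The
   converse rests on the fact that the excedances of a 132-avoiding involution are exactly
   1, ..., c, and that avoidance then says that i is matched with the last X that was still
   free. Both sides are counted by the same recurrence in the numbers of X and Xbar. *)

theory Submission
  imports Defs
begin

section \<open>Ballot words and stack sequences\<close>

definition ballot_words :: "nat \<Rightarrow> nat \<Rightarrow> letter list set" where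
  "ballot_words a c = {w \<in> primitive_dyck_words. count_list w X = a \<and> count_list w Xbar = c}"

text \<open>Entry \<^term>\<open>i\<close> is the index, counted from the left, of the \<^term>\<open>X\<close> that the
  \<^term>\<open>i\<close>-th \<^term>\<open>Xbar\<close> closes. The word itself need not be recorded:
  it suffices that every index strictly between that of the \<^term>\<open>X\<close> being closed and a
  larger one used before has been used before, too.\<close>

definition stack_seqs :: "nat \<Rightarrow> nat \<Rightarrow> nat list set" where
  "stack_seqs a c = {xs. length xs = c \<and> distinct xs \<and> set xs \<subseteq> {..<a} \<and>
     (\<forall>j<c. \<forall>i<j. \<forall>x. xs ! j < x \<and> x < xs ! i \<longrightarrow> x \<in> set (take j xs))}"

section \<open>Ballot words, decomposed by their last letter\<close>

lemma length_eq_counts: "length w = count_list w X + count_list w Xbar"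
proof (induction w)
  case (Cons l w)
  then show ?case by (cases l) auto
qed simp

text \<open>The only prefix of \<open>w @ [l]\<close> that is not already a prefix of
  \<open>w\<close> is the whole word.\<close>

lemma primitive_dyck_words_snoc:
  "w @ [l] \<in> primitive_dyck_words \<longleftrightarrow>
     w \<in> primitive_dyck_words \<and> count_list (w @ [l]) Xbar \<le> count_list (w @ [l]) X"
proof
  assume *: "w @ [l] \<in> primitive_dyck_words"
  have "count_list u Xbar \<le> count_list u X" if "w = u @ v" for u v
    using * that unfolding primitive_dyck_words_def by (metis (mono_tags, lifting) append_assoc mem_Collect_eq)
  moreover have "count_list (w @ [l]) Xbar \<le> count_list (w @ [l]) X"
    using * unfolding primitive_dyck_words_def by (metis (mono_tags, lifting) append_Nil2 mem_Collect_eq)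
  ultimately show "w \<in> primitive_dyck_words \<and> count_list (w @ [l]) Xbar \<le> count_list (w @ [l]) X"
    unfolding primitive_dyck_words_def by blast
next
  assume *: "w \<in> primitive_dyck_words \<and> count_list (w @ [l]) Xbar \<le> count_list (w @ [l]) X"
  have "count_list u Xbar \<le> count_list u X" if "w @ [l] = u @ v" for u v
  proof (cases v rule: rev_cases)
    case Nil
    with that * show ?thesis by simp
  next
    case (snoc v' y)
    with that have "w = u @ v'" by simp
    with * show ?thesis unfolding primitive_dyck_words_def by blast
  qed
  then show "w @ [l] \<in> primitive_dyck_words"
    unfolding primitive_dyck_words_def by blast
qed

lemma ballot_words_no_Xbar: "ballot_words a 0 = {replicate a X}"
proof (intro set_eqI iffI)
  fix w assume "w \<in> ballot_words a 0"
  then have len: "length w = a" and "Xbar \<notin> set w"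
    by (auto simp: ballot_words_def length_eq_counts count_list_0_iff)
  then have "\<forall>y\<in>set w. y = X"
    by (metis letter.exhaust)
  then show "w \<in> {replicate a X}"
    using len by (metis replicate_length_same singleton_iff)
next
  fix w :: "letter list" assume "w \<in> {replicate a X}"
  then have w: "w = replicate a X" by simp
  then have "Xbar \<notin> set w" by auto
  moreover have "w \<in> primitive_dyck_words"
    unfolding primitive_dyck_words_def using \<open>Xbar \<notin> set w\<close> by (auto simp: count_list_0_iff)
  ultimately show "w \<in> ballot_words a 0"
    using length_eq_counts[of w] by (simp add: ballot_words_def count_list_0_iff w)
qed

lemma ballot_words_empty: "a < c \<Longrightarrow> ballot_words a c = {}"
proof -
  have "count_list w Xbar \<le> count_list w X" if "w \<in> primitive_dyck_words" for w
    using that append_Nil2[of w, symmetric] unfolding primitive_dyck_words_def by blast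
  then show "a < c \<Longrightarrow> ballot_words a c = {}" unfolding ballot_words_def by fastforce
qed

text \<open>Delete the last letter. The hypothesis \<open>c \<le> a\<close> is what allows a final
  \<open>Xbar\<close> to be put back: the total counts are then
  \<open>Suc c \<le> Suc a\<close>.\<close>

lemma ballot_words_rec:
  assumes "c \<le> a"
  shows "ballot_words (Suc a) (Suc c) =
    (\<lambda>w. w @ [X]) ` ballot_words a (Suc c) \<union> (\<lambda>w. w @ [Xbar]) ` ballot_words (Suc a) c"
proof (intro set_eqI iffI)
  fix w assume w: "w \<in> ballot_words (Suc a) (Suc c)"
  then obtain v l where v: "w = v @ [l]"
    by (cases w rule: rev_cases) (auto simp: ballot_words_def)
  show "w \<in> (\<lambda>w. w @ [X]) ` ballot_words a (Suc c) \<union> (\<lambda>w. w @ [Xbar]) ` ballot_words (Suc a) c"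
    using w unfolding v by (cases l) (auto simp: ballot_words_def primitive_dyck_words_snoc)
next
  fix w assume w: "w \<in> (\<lambda>w. w @ [X]) ` ballot_words a (Suc c) \<union> (\<lambda>w. w @ [Xbar]) ` ballot_words (Suc a) c"
  then show "w \<in> ballot_words (Suc a) (Suc c)"
    using assms by (auto simp: ballot_words_def primitive_dyck_words_snoc)
qed

lemma finite_ballot_words: "finite (ballot_words a c)"
proof (rule finite_subset)
  show "ballot_words a c \<subseteq> {w. set w \<subseteq> {X, Xbar} \<and> length w = a + c}"
    using letter.exhaust by (auto simp: ballot_words_def length_eq_counts)
qed (rule finite_lists_length_eq, simp)

section \<open>Stack sequences, decomposed by the use of their largest index\<close>

lemma stack_seqs_snoc:
  "xs @ [y] \<in> stack_seqs a (Suc c) \<longleftrightarrow>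
     xs \<in> stack_seqs a c \<and> y < a \<and> y \<notin> set xs \<and>
     (\<forall>z\<in>set xs. \<forall>x. y < x \<and> x < z \<longrightarrow> x \<in> set xs)"
proof (cases "length xs = c")
  case True
  \<comment> \<open>The clauses with \<open>j < c\<close> see entries of \<open>xs\<close> only; the
    clause \<open>j = c\<close> is the new one, about \<open>y\<close>.\<close>
  have st: "(\<forall>j<Suc c. \<forall>i<j. \<forall>x. (xs @ [y]) ! j < x \<and> x < (xs @ [y]) ! i \<longrightarrow> x \<in> set (take j (xs @ [y]))) \<longleftrightarrow>
    (\<forall>j<c. \<forall>i<j. \<forall>x. xs ! j < x \<and> x < xs ! i \<longrightarrow> x \<in> set (take j xs)) \<and>
    (\<forall>i<c. \<forall>x. y < x \<and> x < xs ! i \<longrightarrow> x \<in> set xs)"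
    unfolding All_less_Suc using True by (simp add: nth_append conj_commute)
  have last: "(\<forall>i<c. \<forall>x. y < x \<and> x < xs ! i \<longrightarrow> x \<in> set xs) \<longleftrightarrow>
    (\<forall>z\<in>set xs. \<forall>x. y < x \<and> x < z \<longrightarrow> x \<in> set xs)"
    using True by (metis in_set_conv_nth)
  have simple: "distinct (xs @ [y]) \<longleftrightarrow> distinct xs \<and> y \<notin> set xs"
    "length (xs @ [y]) = Suc c \<longleftrightarrow> length xs = c"
    "set (xs @ [y]) \<subseteq> {..<a} \<longleftrightarrow> set xs \<subseteq> {..<a} \<and> y < a" by auto
  show ?thesis
    unfolding stack_seqs_def mem_Collect_eq st last simple by argo
next
  case False
  then show ?thesis by (simp add: stack_seqs_def)
qed

text \<open>This isolates the sequences in which the last \<open>X\<close> stays unmatched; they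
  correspond to the words ending in \<open>X\<close>.\<close>

lemma stack_seqs_Suc: "xs \<in> stack_seqs a c \<longleftrightarrow> xs \<in> stack_seqs (Suc a) c \<and> a \<notin> set xs"
proof -
  have "set xs \<subseteq> {..<a} \<longleftrightarrow> set xs \<subseteq> {..<Suc a} \<and> a \<notin> set xs"
    by (auto simp: less_Suc_eq)
  then show ?thesis unfolding stack_seqs_def by blast
qed

lemma stack_seqs_zero: "stack_seqs a 0 = {[]}"
  by (auto simp: stack_seqs_def)

lemma stack_seqs_empty:
  assumes "a < c" shows "stack_seqs a c = {}"
proof -
  have "length xs \<le> a" if "distinct xs" "set xs \<subseteq> {..<a}" for xs :: "nat list"
    using card_mono[OF _ that(2)] distinct_card[OF that(1)] by simp
  then show ?thesis using assms by (fastforce simp: stack_seqs_def)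
qed

lemma finite_stack_seqs: "finite (stack_seqs a c)"
proof (rule finite_subset)
  show "stack_seqs a c \<subseteq> {xs. set xs \<subseteq> {..<a} \<and> length xs = c}"
    unfolding stack_seqs_def by blast
qed (rule finite_lists_length_eq, simp)

text \<open>The top of the stack: the last \<open>X\<close> still open once all \<open>Suc a\<close>
  of them, indexed from 0 to \<open>a\<close>, have been read and those in \<open>xs\<close>
  closed.\<close>

definition top_free :: "nat \<Rightarrow> nat list \<Rightarrow> nat" where
  "top_free a xs = Max ({..a} - set xs)"

lemma stack_seqs_le: "xs \<in> stack_seqs (Suc a) c \<Longrightarrow> z \<in> set xs \<Longrightarrow> z \<le> a"
  unfolding stack_seqs_def by (auto simp: subset_iff less_Suc_eq_le)

text \<open>This mirrors the split of words by their last letter. If the largest index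
  \<open>a\<close> is used, the last entry \<open>y\<close> is forced: either \<open>y = a\<close>,
  or \<open>a\<close> came earlier and the stack condition makes every index between
  \<open>y\<close> and \<open>a\<close> used already. So \<open>y\<close> is the largest free
  index.\<close>

lemma stack_seqs_rec:
  assumes "c \<le> a"
  shows "stack_seqs (Suc a) (Suc c) =
    stack_seqs a (Suc c) \<union> (\<lambda>xs. xs @ [top_free a xs]) ` stack_seqs (Suc a) c"
proof (intro set_eqI iffI)
  fix zs assume zs: "zs \<in> stack_seqs (Suc a) (Suc c)"
  show "zs \<in> stack_seqs a (Suc c) \<union> (\<lambda>xs. xs @ [top_free a xs]) ` stack_seqs (Suc a) c"
  proof (cases "a \<in> set zs")
    case False
    then show ?thesis using zs by (simp add: stack_seqs_Suc[of zs a])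
  next
    case True
    then obtain xs y where xs: "zs = xs @ [y]"
      by (cases zs rule: rev_cases) auto
    have y: "xs \<in> stack_seqs (Suc a) c" "y \<le> a" "y \<notin> set xs"
      "\<And>z x. z \<in> set xs \<Longrightarrow> y < x \<Longrightarrow> x < z \<Longrightarrow> x \<in> set xs"
      using zs unfolding xs stack_seqs_snoc by auto
    have "x \<le> y" if "x \<le> a" "x \<notin> set xs" for x
    proof (rule ccontr)
      assume "\<not> x \<le> y"
      then have "a \<in> set xs" using True that by (auto simp: xs)
      then have "x < a" using that by (metis le_neq_implies_less)
      then show False using y(4)[OF \<open>a \<in> set xs\<close>, of x] \<open>\<not> x \<le> y\<close> that by simp
    qed
    then have "top_free a xs = y"
      unfolding top_free_def by (intro Max_eqI) (use y in auto)
    then show ?thesis using xs y(1) by auto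
  qed
next
  fix zs assume "zs \<in> stack_seqs a (Suc c) \<union> (\<lambda>xs. xs @ [top_free a xs]) ` stack_seqs (Suc a) c"
  then consider "zs \<in> stack_seqs a (Suc c)"
    | xs where "xs \<in> stack_seqs (Suc a) c" "zs = xs @ [top_free a xs]" by blast
  then show "zs \<in> stack_seqs (Suc a) (Suc c)"
  proof cases
    case 1
    then show ?thesis by (simp add: stack_seqs_Suc[of zs a])
  next
    case 2
    then have xs: "length xs = c" unfolding stack_seqs_def by blast
    \<comment> \<open>At most \<open>c \<le> a\<close> of the \<open>Suc a\<close> indices are used,
      so the maximum in \<open>top_free\<close> is taken over a nonempty set.\<close>
    have "card (set xs) < card {..a}"
      using card_length[of xs] xs(1) assms by simp
    then have "{..a} - set xs \<noteq> {}"
      by (metis Diff_eq_empty_iff List.finite_set card_mono leD)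
    then have "top_free a xs \<in> {..a} - set xs"
      unfolding top_free_def by (intro Max_in) auto
    moreover have "x \<in> set xs" if "top_free a xs < x" "x \<le> a" for x
    proof (rule ccontr)
      assume "x \<notin> set xs"
      then have "x \<le> top_free a xs"
        unfolding top_free_def using that by (intro Max_ge) auto
      then show False using that by simp
    qed
    ultimately show ?thesis
      using 2(1) unfolding 2(2) stack_seqs_snoc
      by (metis DiffD1 DiffD2 atMost_iff le_less_trans less_Suc_eq_le nat_less_le stack_seqs_le)
  qed
qed

text \<open>Every sequence of the second kind contains \<open>a\<close>: if \<open>a\<close> is not
  in \<open>xs\<close>, it is the largest free index and gets appended.\<close>

lemma stack_seqs_rec_disjoint:
  "stack_seqs a (Suc c) \<inter> (\<lambda>xs. xs @ [top_free a xs]) ` stack_seqs (Suc a) c = {}"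
proof -
  have "a \<in> set (xs @ [top_free a xs])" if "xs \<in> stack_seqs (Suc a) c" for xs
  proof (rule ccontr)
    assume *: "\<not> ?thesis"
    then have "top_free a xs = a"
      unfolding top_free_def by (intro Max_eqI) auto
    with * show False by simp
  qed
  then show ?thesis using stack_seqs_Suc by blast
qed

text \<open>The two recurrences agree, and so do the boundary cases \<open>c = 0\<close> and
  \<open>a < c\<close>. Both summands of a recurrence have index sum one less than
  \<open>a + c\<close>.\<close>

lemma card_ballot_words: "card (ballot_words a c) = card (stack_seqs a c)"
proof (induction "a + c" arbitrary: a c rule: less_induct)
  case less
  have "c = 0 \<or> a < c \<or> (\<exists>a' c'. a = Suc a' \<and> c = Suc c' \<and> c' \<le> a')"
    by (cases a; cases c) auto
  then consider "c = 0" | "a < c" | a' c' where "a = Suc a'" "c = Suc c'" "c' \<le> a'"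
    by blast
  then show ?case
  proof cases
    case 1
    then show ?thesis by (simp add: ballot_words_no_Xbar stack_seqs_zero)
  next
    case 2
    then show ?thesis by (simp add: ballot_words_empty stack_seqs_empty)
  next
    case 3
    have "card (ballot_words a c) = card (ballot_words a' (Suc c')) + card (ballot_words (Suc a') c')"
      unfolding 3(1,2) ballot_words_rec[OF 3(3)]
      by (subst card_Un_disjoint) (auto simp: finite_ballot_words card_image inj_on_def)
    also have "\<dots> = card (stack_seqs a' (Suc c')) + card (stack_seqs (Suc a') c')"
      using less[of a' "Suc c'"] less[of "Suc a'" c'] 3 by simp
    also have "\<dots> = card (stack_seqs a c)"
      unfolding 3(1,2) stack_seqs_rec[OF 3(3)]
      by (subst card_Un_disjoint)
        (auto simp: finite_stack_seqs card_image inj_on_def stack_seqs_rec_disjoint)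
    finally show ?thesis .
  qed
qed

section \<open>Involutions avoiding 132\<close>

lemma contains_pattern_132_iff:
  "contains_pattern n \<alpha> 3 pattern_132 \<longleftrightarrow>
     (\<exists>p q r. 1 \<le> p \<and> p < q \<and> q < r \<and> r \<le> n \<and> \<alpha> p < \<alpha> r \<and> \<alpha> r < \<alpha> q)"
proof -
  have three: "{1..3::nat} = {1, 2, 3}" by auto
  have pat: "pattern_132 1 = 1" "pattern_132 2 = 3" "pattern_132 3 = 2"
    by (auto simp: pattern_132_def transpose_def)
  show ?thesis
  proof
    assume "contains_pattern n \<alpha> 3 pattern_132"
    then obtain i where i: "strict_mono_on {1..3} i" "i ` {1..3} \<subseteq> {1..n}"
      "\<forall>a\<in>{1..3}. \<forall>b\<in>{1..3}. \<alpha> (i a) < \<alpha> (i b) \<longleftrightarrow> pattern_132 a < pattern_132 b"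
      unfolding contains_pattern_def by auto
    have "i 1 < i 2" "i 2 < i 3"
      using i(1) by (auto simp: strict_mono_on_def)
    moreover have "1 \<le> i 1" "i 3 \<le> n" using i(2) by (auto simp: three simp flip: One_nat_def)
    moreover have "\<alpha> (i 1) < \<alpha> (i 3)" "\<alpha> (i 3) < \<alpha> (i 2)"
      using i(3) pat by (auto simp: three)
    ultimately show "\<exists>p q r. 1 \<le> p \<and> p < q \<and> q < r \<and> r \<le> n \<and> \<alpha> p < \<alpha> r \<and> \<alpha> r < \<alpha> q"
      by blast
  next
    assume "\<exists>p q r. 1 \<le> p \<and> p < q \<and> q < r \<and> r \<le> n \<and> \<alpha> p < \<alpha> r \<and> \<alpha> r < \<alpha> q"
    then obtain p q r where pqr: "1 \<le> p" "p < q" "q < r" "r \<le> n" "\<alpha> p < \<alpha> r" "\<alpha> r < \<alpha> q"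
      by blast
    define i :: "nat \<Rightarrow> nat" where "i = (\<lambda>a. if a = 1 then p else if a = 2 then q else r)"
    have "strict_mono_on {1..3} i" "i ` {1..3} \<subseteq> {1..n}"
      using pqr by (auto simp: i_def three strict_mono_on_def)
    moreover have "\<forall>a\<in>{1..3}. \<forall>b\<in>{1..3}. \<alpha> (i a) < \<alpha> (i b) \<longleftrightarrow> pattern_132 a < pattern_132 b"
      unfolding three using pqr pat by (simp add: i_def)
    ultimately show "contains_pattern n \<alpha> 3 pattern_132"
      unfolding contains_pattern_def by blast
  qed
qed

definition excedances :: "nat \<Rightarrow> (nat \<Rightarrow> nat) \<Rightarrow> nat set" where
  "excedances n \<alpha> = {i \<in> {1..n}. i < \<alpha> i}"

text \<open>Since permutations are the identity outside \<open>{1..n}\<close>, the involution law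
  holds everywhere and can later be used for rewriting without range conditions.\<close>

lemma involutions_iff:
  "\<alpha> \<in> involutions n \<longleftrightarrow> (\<forall>i. \<alpha> (\<alpha> i) = i) \<and> (\<forall>i. i \<notin> {1..n} \<longrightarrow> \<alpha> i = i)"
proof
  assume "\<alpha> \<in> involutions n"
  then have perm: "\<alpha> permutes {1..n}" and inv: "\<forall>i\<in>{1..n}. \<alpha> (\<alpha> i) = i"
    by (simp_all add: involutions_def)
  have out: "\<alpha> i = i" if "i \<notin> {1..n}" for i
    using perm that by (rule permutes_not_in)
  have "\<alpha> (\<alpha> i) = i" for i
    using inv out[of i] by (cases "i \<in> {1..n}") (blast, simp)
  with out show "(\<forall>i. \<alpha> (\<alpha> i) = i) \<and> (\<forall>i. i \<notin> {1..n} \<longrightarrow> \<alpha> i = i)"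
    by blast
next
  assume *: "(\<forall>i. \<alpha> (\<alpha> i) = i) \<and> (\<forall>i. i \<notin> {1..n} \<longrightarrow> \<alpha> i = i)"
  then have "\<alpha> permutes {1..n}" unfolding permutes_def by metis
  with * show "\<alpha> \<in> involutions n" by (simp add: involutions_def)
qed

lemma involution_image:
  assumes "\<alpha> \<in> involutions n" "i \<in> {1..n}" shows "\<alpha> i \<in> {1..n}"
  using assms unfolding involutions_def by (simp add: permutes_in_image del: atLeastAtMost_iff)

lemma down_closed_eq_interval:
  fixes S :: "nat set"
  assumes "finite S" "0 \<notin> S" and down: "\<And>i j. 1 \<le> i \<Longrightarrow> i < j \<Longrightarrow> j \<in> S \<Longrightarrow> i \<in> S"
  shows "S = {1..card S}"
proof (cases "S = {}")
  case False
  have "S = {1..Max S}"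
  proof (intro set_eqI iffI)
    fix i assume "i \<in> S"
    with assms(1,2) show "i \<in> {1..Max S}"
      by (metis Max_ge atLeastAtMost_iff less_one not_le)
  next
    fix i assume "i \<in> {1..Max S}"
    then show "i \<in> S"
      using down[of i "Max S"] Max_in[OF assms(1) False] by (cases "i = Max S") auto
  qed
  then show ?thesis by (metis card_atLeastAtMost diff_Suc_1)
qed simp

text \<open>An occurrence of 132 whose middle entry is not an excedance can be reflected
  in the diagonal, which turns its entry playing the role of 2 into the middle one.\<close>

lemma avoids_132_iff:
  assumes inv: "\<alpha> \<in> involutions n"
  shows "avoids_pattern n \<alpha> 3 pattern_132 \<longleftrightarrow>
    excedances n \<alpha> = {1..card (excedances n \<alpha>)} \<and>
    (\<forall>j\<in>excedances n \<alpha>. \<forall>i\<in>{1..<j}. \<forall>p. \<alpha> i < p \<and> p < \<alpha> j \<longrightarrow> \<alpha> p < j)"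
proof
  assume "avoids_pattern n \<alpha> 3 pattern_132"
  then have av: False if "1 \<le> p" "p < q" "q < r" "r \<le> n" "\<alpha> p < \<alpha> r" "\<alpha> r < \<alpha> q" for p q r
    using that unfolding avoids_pattern_def contains_pattern_132_iff by blast
  have "i \<in> excedances n \<alpha>" if "1 \<le> i" "i < j" "j \<in> excedances n \<alpha>" for i j
  proof (rule ccontr)
    assume "i \<notin> excedances n \<alpha>"
    then have "\<alpha> i \<le> i" using that by (auto simp: excedances_def)
    \<comment> \<open>The positions \<open>i < j < \<alpha> j\<close> carry the values
      \<open>\<alpha> i\<close>, \<open>\<alpha> j\<close>, \<open>j\<close>, and
      \<open>\<alpha> i \<le> i < j < \<alpha> j\<close>: an occurrence of 132.\<close>
    then show False
      using av[of i j "\<alpha> j"] that inv involution_image[OF inv, of j]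
      by (auto simp: excedances_def involutions_iff)
  qed
  then have "excedances n \<alpha> = {1..card (excedances n \<alpha>)}"
    by (intro down_closed_eq_interval) (auto simp: excedances_def)
  moreover have "\<alpha> p < j"
    if "j \<in> excedances n \<alpha>" "i \<in> {1..<j}" "\<alpha> i < p" "p < \<alpha> j" for i j p
  proof (rule ccontr)
    assume "\<not> \<alpha> p < j"
    \<comment> \<open>Equality is excluded because \<open>p < \<alpha> j\<close>. The forbidden
      occurrence then sits at \<open>i < j < \<alpha> p\<close>, with the values
      \<open>\<alpha> i\<close>, \<open>\<alpha> j\<close>, \<open>p\<close>.\<close>
    then have "j < \<alpha> p"
      using inv that by (metis involutions_iff less_irrefl linorder_neqE_nat)
    moreover have "j \<in> {1..n}" "p \<in> {1..n}"
      using that involution_image[OF inv, of j] by (auto simp: excedances_def)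
    moreover have "\<alpha> p \<le> n"
      using involution_image[OF inv] \<open>p \<in> {1..n}\<close> by auto
    ultimately show False
      using av[of i j "\<alpha> p"] that inv by (auto simp: involutions_iff)
  qed
  ultimately show "excedances n \<alpha> = {1..card (excedances n \<alpha>)} \<and>
    (\<forall>j\<in>excedances n \<alpha>. \<forall>i\<in>{1..<j}. \<forall>p. \<alpha> i < p \<and> p < \<alpha> j \<longrightarrow> \<alpha> p < j)" by blast
next
  assume *: "excedances n \<alpha> = {1..card (excedances n \<alpha>)} \<and>
    (\<forall>j\<in>excedances n \<alpha>. \<forall>i\<in>{1..<j}. \<forall>p. \<alpha> i < p \<and> p < \<alpha> j \<longrightarrow> \<alpha> p < j)"
  have False if pqr: "1 \<le> p" "p < q" "q < r" "r \<le> n" "\<alpha> p < \<alpha> r" "\<alpha> r < \<alpha> q" for p q r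
  proof (cases "q \<in> excedances n \<alpha>")
    case True
    then show False using *[THEN conjunct2, rule_format, of q p "\<alpha> r"] pqr inv
      by (auto simp: involutions_iff)
  next
    case False
    have rng: "\<alpha> p \<in> {1..n}" "\<alpha> r \<in> {1..n}" using pqr involution_image[OF inv] by auto
    have "\<alpha> q \<le> q" using False pqr by (auto simp: excedances_def)
    \<comment> \<open>The reflected occurrence has positions
      \<open>\<alpha> p < \<alpha> r < \<alpha> q\<close> and values \<open>p\<close>,
      \<open>r\<close>, \<open>q\<close>. Its middle position is an excedance by
      \<open>\<alpha> r < \<alpha> q \<le> q < r\<close>.\<close>
    then have "\<alpha> r \<in> excedances n \<alpha>"
      using pqr rng inv by (auto simp: excedances_def involutions_iff)
    then have "\<alpha> q < \<alpha> r"
      using *[THEN conjunct2, rule_format, of "\<alpha> r" "\<alpha> p" q] pqr rng inv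
      by (auto simp: involutions_iff)
    then show False using pqr by simp
  qed
  then show "avoids_pattern n \<alpha> 3 pattern_132"
    unfolding avoids_pattern_def contains_pattern_132_iff by blast
qed

text \<open>An involution exchanges its excedances with the positions it maps below themselves, so
  both kinds are equally numerous.\<close>

lemma card_fixed_points:
  assumes inv: "\<alpha> \<in> involutions n"
  shows "card (fixed_points n \<alpha>) + 2 * card (excedances n \<alpha>) = n"
proof -
  have invol: "\<alpha> (\<alpha> i) = i" for i using inv by (simp add: involutions_iff)
  have "bij_betw \<alpha> (excedances n \<alpha>) {i \<in> {1..n}. \<alpha> i < i}"
  proof (rule bij_betwI[where g = \<alpha>])
    show "\<alpha> \<in> excedances n \<alpha> \<rightarrow> {i \<in> {1..n}. \<alpha> i < i}"
      using involution_image[OF inv] by (simp add: excedances_def invol del: atLeastAtMost_iff)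
    show "\<alpha> \<in> {i \<in> {1..n}. \<alpha> i < i} \<rightarrow> excedances n \<alpha>"
      using involution_image[OF inv] by (simp add: excedances_def invol del: atLeastAtMost_iff)
  qed (simp_all add: invol)
  then have "card {i \<in> {1..n}. \<alpha> i < i} = card (excedances n \<alpha>)"
    by (simp add: bij_betw_same_card)
  moreover have "{1..n} = fixed_points n \<alpha> \<union> (excedances n \<alpha> \<union> {i \<in> {1..n}. \<alpha> i < i})"
    by (auto simp: fixed_points_def excedances_def)
  then have "n = card (fixed_points n \<alpha> \<union> (excedances n \<alpha> \<union> {i \<in> {1..n}. \<alpha> i < i}))"
    by (metis card_atLeastAtMost diff_Suc_1)
  moreover have "\<dots> = card (fixed_points n \<alpha>) + card (excedances n \<alpha> \<union> {i \<in> {1..n}. \<alpha> i < i})"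
    by (rule card_Un_disjoint) (auto simp: fixed_points_def excedances_def)
  moreover have "card (excedances n \<alpha> \<union> {i \<in> {1..n}. \<alpha> i < i}) =
      card (excedances n \<alpha>) + card {i \<in> {1..n}. \<alpha> i < i}"
    by (rule card_Un_disjoint) (auto simp: excedances_def)
  ultimately show ?thesis by simp
qed

text \<open>A position mapped below itself is the image of an excedance, so its value is determined
  by the values at excedances.\<close>

lemma involution_eqI:
  assumes inv: "\<alpha> \<in> involutions n" "\<beta> \<in> involutions n"
    and exc: "excedances n \<alpha> = excedances n \<beta>"
    and eq: "\<And>i. i \<in> excedances n \<alpha> \<Longrightarrow> \<alpha> i = \<beta> i"
  shows "\<alpha> = \<beta>"
proof -
  \<comment> \<open>The fact is stated for arbitrary involutions because it is used a second time
    with the two exchanged.\<close>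
  have *: "\<alpha> i = \<beta> i" if "\<alpha> i < i" "\<alpha> \<in> involutions n" "\<beta> \<in> involutions n"
    "\<And>i. i \<in> excedances n \<alpha> \<Longrightarrow> \<alpha> i = \<beta> i" for \<alpha> \<beta> :: "nat \<Rightarrow> nat" and i
  proof -
    have "i \<in> {1..n}" using that(1,2) by (metis involutions_iff less_irrefl)
    then have "\<alpha> i \<in> {1..n}" using that(2) by (rule involution_image[rotated])
    moreover have invol: "\<alpha> (\<alpha> i) = i" using that(2) by (simp add: involutions_iff)
    ultimately have "\<alpha> i \<in> excedances n \<alpha>" using that(1) by (simp add: excedances_def)
    then have "\<beta> (\<alpha> i) = i" using that(4) invol by simp
    then show ?thesis using that(3) by (metis involutions_iff)
  qed
  show ?thesis
  proof
    fix i
    show "\<alpha> i = \<beta> i"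
    proof (cases "i \<in> excedances n \<alpha> \<or> i \<notin> {1..n}")
      case True
      then show ?thesis using eq inv by (metis involutions_iff)
    next
      case False
      then have "i \<notin> excedances n \<alpha>" "i \<notin> excedances n \<beta>" "i \<in> {1..n}" using exc by blast+
      then have "\<alpha> i \<le> i" "\<beta> i \<le> i" by (simp_all add: excedances_def)
      then consider "\<alpha> i < i" | "\<beta> i < i" | "\<alpha> i = i" "\<beta> i = i" by linarith
      then show ?thesis
      proof cases
        case 1
        then show ?thesis by (rule *[OF _ inv eq])
      next
        case 2
        then have "\<beta> i = \<alpha> i" by (rule *[OF _ inv(2,1)]) (simp add: exc eq)
        then show ?thesis by simp
      qed simp
    qed
  qed
qed

section \<open>Avoiders with \<open>c\<close> excedances, that is \<open>c\<close> two-cycles,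
  encoded by stack sequences\<close>

definition avoiders :: "nat \<Rightarrow> nat \<Rightarrow> (nat \<Rightarrow> nat) set" where
  "avoiders n c = {\<alpha> \<in> involutions_avoiding_132 n. card (excedances n \<alpha>) = c}"

text \<open>The excedances of an avoider form an initial interval, so their number alone determines
  them.\<close>

lemma avoiders_iff:
  "\<alpha> \<in> avoiders n c \<longleftrightarrow> \<alpha> \<in> involutions n \<and> excedances n \<alpha> = {1..c} \<and>
    (\<forall>j\<in>{1..c}. \<forall>i\<in>{1..<j}. \<forall>p. \<alpha> i < p \<and> p < \<alpha> j \<longrightarrow> \<alpha> p < j)"
proof (cases "\<alpha> \<in> involutions n")
  case True
  show ?thesis
  proof (cases "excedances n \<alpha> = {1..c}")
    case exc: True
    then have "card (excedances n \<alpha>) = c" by simp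
    then show ?thesis
      unfolding avoiders_def involutions_avoiding_132_def mem_Collect_eq avoids_132_iff[OF True]
      using True exc by blast
  next
    case False
    then show ?thesis
      unfolding avoiders_def involutions_avoiding_132_def mem_Collect_eq avoids_132_iff[OF True]
      by blast
  qed
qed (simp add: avoiders_def involutions_avoiding_132_def)

text \<open>The letters \<open>X\<close> bear the labels \<open>n\<close>, \<open>n - 1\<close>, and
  so on, so label \<open>m\<close> belongs to the \<open>X\<close> of index \<open>n - m\<close>,
  counted from 0. Entry \<open>i\<close> is thus the partner of the \<open>Xbar\<close> labelled
  \<open>Suc i\<close>.\<close>

definition excedance_seq :: "nat \<Rightarrow> nat \<Rightarrow> (nat \<Rightarrow> nat) \<Rightarrow> nat list" where
  "excedance_seq n c \<alpha> = map (\<lambda>i. n - \<alpha> (Suc i)) [0..<c]"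

lemma excedance_seq_inj: "inj_on (excedance_seq n c) (avoiders n c)"
proof (rule inj_onI)
  fix \<alpha> \<beta> assume *: "\<alpha> \<in> avoiders n c" "\<beta> \<in> avoiders n c" "excedance_seq n c \<alpha> = excedance_seq n c \<beta>"
  show "\<alpha> = \<beta>"
  proof (rule involution_eqI)
    show "\<alpha> \<in> involutions n" "\<beta> \<in> involutions n" "excedances n \<alpha> = excedances n \<beta>"
      using * unfolding avoiders_iff by simp_all
    fix i assume i: "i \<in> excedances n \<alpha>"
    then have "i \<in> {1..n}" by (auto simp: excedances_def)
    then have "\<alpha> i \<in> {1..n}" "\<beta> i \<in> {1..n}"
      using * involution_image unfolding avoiders_iff by blast+
    moreover have "i \<in> {1..c}" using * i unfolding avoiders_iff by simp
    then obtain k where k: "i = Suc k" "k < c" by (cases i) auto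
    have "n - \<alpha> i = n - \<beta> i"
      using arg_cong[OF *(3), of "\<lambda>xs. xs ! k"] k by (simp add: excedance_seq_def)
    ultimately show "\<alpha> i = \<beta> i" by auto
  qed
qed

text \<open>The reflection \<open>x \<mapsto> n - x\<close> turns the avoidance condition for values
  of \<open>\<alpha>\<close> into the stack condition for indices.\<close>

lemma excedance_seq_in_stack_seqs:
  assumes "\<alpha> \<in> avoiders n c" shows "excedance_seq n c \<alpha> \<in> stack_seqs (n - c) c"
proof -
  have inv: "\<alpha> \<in> involutions n" and exc: "excedances n \<alpha> = {1..c}"
    and st: "\<And>i j p. 1 \<le> i \<Longrightarrow> i < j \<Longrightarrow> j \<le> c \<Longrightarrow> \<alpha> i < p \<Longrightarrow> p < \<alpha> j \<Longrightarrow> \<alpha> p < j"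
    using assms unfolding avoiders_iff by simp_all
  have invol: "\<alpha> (\<alpha> i) = i" for i using inv by (simp add: involutions_iff)
  have gt: "c < \<alpha> i \<and> \<alpha> i \<le> n" if "i \<in> {1..c}" for i
  proof -
    have i: "i \<in> excedances n \<alpha>" using that exc by simp
    then have "\<alpha> i \<in> {1..n}" using involution_image[OF inv] by (auto simp: excedances_def)
    \<comment> \<open>Otherwise \<open>\<alpha> i\<close> would be an excedance, although its image
      \<open>i\<close> is smaller.\<close>
    moreover have "\<alpha> i \<notin> {1..c}"
      unfolding exc[symmetric] using i invol by (auto simp: excedances_def)
    ultimately show ?thesis by auto
  qed
  have len: "length (excedance_seq n c \<alpha>) = c" by (simp add: excedance_seq_def)
  have nth: "excedance_seq n c \<alpha> ! i = n - \<alpha> (Suc i)" if "i < c" for i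
    using that by (simp add: excedance_seq_def)
  have "inj_on (\<lambda>i. n - \<alpha> (Suc i)) {0..<c}"
  proof (rule inj_onI)
    fix i j assume "i \<in> {0..<c}" "j \<in> {0..<c}" "n - \<alpha> (Suc i) = n - \<alpha> (Suc j)"
    then have "\<alpha> (Suc i) = \<alpha> (Suc j)" using gt[of "Suc i"] gt[of "Suc j"] by auto
    then show "i = j" using invol by (metis Suc_inject)
  qed
  then have "distinct (excedance_seq n c \<alpha>)"
    by (simp add: excedance_seq_def distinct_map)
  moreover have "n - \<alpha> (Suc i) < n - c" if "i < c" for i
    using gt[of "Suc i"] that by auto
  then have "set (excedance_seq n c \<alpha>) \<subseteq> {..<n - c}"
    by (auto simp: excedance_seq_def)
  moreover have "x \<in> set (take j (excedance_seq n c \<alpha>))"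
    if "j < c" "i < j" "excedance_seq n c \<alpha> ! j < x" "x < excedance_seq n c \<alpha> ! i" for i j x
  proof -
    have x: "n - \<alpha> (Suc j) < x" "x < n - \<alpha> (Suc i)" using that by (auto simp: nth)
    \<comment> \<open>Here \<open>n - x\<close> lies strictly between
      \<open>\<alpha> (Suc i)\<close> and \<open>\<alpha> (Suc j)\<close>. The bound on its image
      says that it is the partner of an earlier \<open>Suc k\<close>, so \<open>x\<close> is entry
      \<open>k\<close>.\<close>
    have "\<alpha> (n - x) < Suc j"
      by (rule st[of "Suc i"]) (use that x gt[of "Suc j"] in auto)
    moreover have "n - x \<in> {1..n}" using x by auto
    then have "\<alpha> (n - x) \<in> {1..n}" using involution_image[OF inv] by blast
    ultimately obtain k where k: "\<alpha> (n - x) = Suc k" "k < j"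
      by (cases "\<alpha> (n - x)") auto
    then have "\<alpha> (Suc k) = n - x" using invol by metis
    then have "excedance_seq n c \<alpha> ! k = x" using k that x by (simp add: nth)
    then show ?thesis using k that len by (metis in_set_conv_nth length_take min.absorb4 nth_take)
  qed
  ultimately show ?thesis using len by (simp add: stack_seqs_def)
qed

lemma stack_seqs_in_image:
  assumes "xs \<in> stack_seqs (n - c) c"
  shows "xs \<in> excedance_seq n c ` avoiders n c"
proof -
  have xs: "length xs = c" "distinct xs"
    and st: "\<And>i j x. j < c \<Longrightarrow> i < j \<Longrightarrow> xs ! j < x \<Longrightarrow> x < xs ! i \<Longrightarrow> x \<in> set (take j xs)"
    using assms by (auto simp: stack_seqs_def)
  have lt: "xs ! i < n - c" if "i < c" for i
    using that assms by (auto simp: stack_seqs_def subset_iff)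
  \<comment> \<open>The label of the \<open>X\<close> closed by the \<open>Xbar\<close> labelled
    \<open>i\<close>; labels start at 1, list positions at 0.\<close>
  define \<rho> where "\<rho> i = n - xs ! (i - 1)" for i
  have \<rho>: "c < \<rho> i \<and> \<rho> i \<le> n" if "i \<in> {1..c}" for i
  proof -
    have "i - 1 < c" using that by auto
    then show ?thesis using lt[of "i - 1"] by (simp add: \<rho>_def)
  qed
  have inj: "inj_on \<rho> {1..c}"
  proof (rule inj_onI)
    fix i j assume *: "i \<in> {1..c}" "j \<in> {1..c}" "\<rho> i = \<rho> j"
    then have ij: "i - 1 < c" "j - 1 < c" by auto
    then have "xs ! (i - 1) = xs ! (j - 1)"
      using lt[OF ij(1)] lt[OF ij(2)] *(3) unfolding \<rho>_def by linarith
    then have "i - 1 = j - 1"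
      using ij xs nth_eq_iff_index_eq by blast
    then show "i = j" using * by auto
  qed
  \<comment> \<open>This swaps \<open>i\<close> and \<open>\<rho> i\<close> for each
    \<open>i\<close> in \<open>{1..c}\<close>. The first two cases are disjoint because all values
    of \<open>\<rho>\<close> exceed \<open>c\<close>.\<close>
  define \<alpha> where "\<alpha> i = (if i \<in> {1..c} then \<rho> i
    else if i \<in> \<rho> ` {1..c} then inv_into {1..c} \<rho> i else i)" for i
  have lo: "\<alpha> i = \<rho> i" if "i \<in> {1..c}" for i using that by (simp add: \<alpha>_def)
  have hi: "\<alpha> (\<rho> i) = i" if "i \<in> {1..c}" for i
    using that \<rho>[OF that] inj by (auto simp: \<alpha>_def)
  have other: "\<alpha> i = i" if "i \<notin> {1..c}" "i \<notin> \<rho> ` {1..c}" for i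
    using that unfolding \<alpha>_def by (simp only: if_False)
  have cases: "i \<in> {1..c} \<or> (\<exists>k\<in>{1..c}. i = \<rho> k) \<or> (i \<notin> {1..c} \<and> i \<notin> \<rho> ` {1..c})" for i
    by blast
  \<comment> \<open>If \<open>c > 0\<close>, entry 0 lies below the truncated difference
    \<open>n - c\<close>, which is therefore positive.\<close>
  have "c \<le> n" using lt[of 0] by (cases "c = 0") auto
  have inv: "\<alpha> \<in> involutions n"
    unfolding involutions_iff
  proof (intro conjI allI impI)
    fix i show "\<alpha> (\<alpha> i) = i"
      using cases[of i] by (elim disjE bexE conjE) (simp_all only: lo hi other not_False_eq_True)
  next
    fix i assume "i \<notin> {1..n}"
    moreover have "\<rho> k \<in> {1..n}" if "k \<in> {1..c}" for k
      using \<rho>[OF that] by simp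
    ultimately show "\<alpha> i = i" using \<open>c \<le> n\<close> by (intro other) auto
  qed
  have exc: "excedances n \<alpha> = {1..c}"
  proof (intro set_eqI iffI)
    fix i assume i: "i \<in> excedances n \<alpha>"
    then have "i < \<alpha> i" by (simp add: excedances_def)
    then show "i \<in> {1..c}"
      using cases[of i]
    proof (elim disjE bexE conjE)
      fix k assume "k \<in> {1..c}" "i = \<rho> k"
      then have "\<alpha> i \<le> c" "c < i" using \<rho> hi by simp_all
      with \<open>i < \<alpha> i\<close> show ?thesis by simp
    qed (use other in auto)
  next
    fix i assume "i \<in> {1..c}"
    then show "i \<in> excedances n \<alpha>"
      using \<rho>[of i] lo[of i] \<open>c \<le> n\<close> by (auto simp: excedances_def)
  qed
  have "\<alpha> p < j" if j: "j \<in> {1..c}" and i: "i \<in> {1..<j}" and p: "\<alpha> i < p" "p < \<alpha> j" for i j p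
  proof -
    have ic: "i \<in> {1..c}" using i j by simp
    have p': "n - xs ! (i - 1) < p" "p < n - xs ! (j - 1)" "p \<le> n"
      using p lo[OF j] lo[OF ic] unfolding \<rho>_def by linarith+
    \<comment> \<open>By the stack condition the \<open>X\<close> labelled \<open>p\<close> was
      closed earlier, so \<open>p\<close> is \<open>\<rho> (Suc k)\<close> for some
      \<open>Suc k < j\<close>, and \<open>\<alpha>\<close> sends it back there.\<close>
    have "n - p \<in> set (take (j - 1) xs)"
      by (rule st[of _ "i - 1"]) (use p' i j in auto)
    then obtain k where k: "k < j - 1" "xs ! k = n - p"
      by (auto simp: in_set_conv_nth)
    then have "p = \<rho> (Suc k)" using p' by (simp add: \<rho>_def)
    moreover have "Suc k \<in> {1..c}" "Suc k < j" using k j by auto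
    ultimately show ?thesis using hi by metis
  qed
  then have "\<alpha> \<in> avoiders n c" using inv exc by (simp add: avoiders_iff)
  moreover have "excedance_seq n c \<alpha> = xs"
  proof (rule nth_equalityI)
    fix i assume "i < length (excedance_seq n c \<alpha>)"
    then have "i < c" by (simp add: excedance_seq_def)
    then show "excedance_seq n c \<alpha> ! i = xs ! i"
      using lo[of "Suc i"] lt[of i] by (simp add: excedance_seq_def \<rho>_def)
  qed (simp add: excedance_seq_def xs)
  ultimately show ?thesis by blast
qed

lemma card_avoiders: "card (avoiders n c) = card (stack_seqs (n - c) c)"
proof (rule bij_betw_same_card)
  show "bij_betw (excedance_seq n c) (avoiders n c) (stack_seqs (n - c) c)"
    using excedance_seq_inj excedance_seq_in_stack_seqs stack_seqs_in_image
    unfolding bij_betw_def by blast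
qed

section \<open>Assembling the bijection fibre by fibre\<close>

lemma finite_involutions_avoiding_132: "finite (involutions_avoiding_132 n)"
  by (rule finite_subset[OF _ finite_permutations[of "{1..n}"]])
    (auto simp: involutions_avoiding_132_def involutions_def)

text \<open>The fibres of \<open>g\<close> and \<open>h\<close> partition the two sets, so
  bijections between corresponding fibres glue together. This turns equal counts into a bijection
  that respects the statistics.\<close>

lemma ex_bij_betw_fibrewise:
  assumes "finite A" "finite B"
    and card: "\<And>c. card {x \<in> A. g x = c} = card {y \<in> B. h y = c}"
  shows "\<exists>\<Phi>. bij_betw \<Phi> A B \<and> (\<forall>x\<in>A. h (\<Phi> x) = g x)"
proof -
  have "\<exists>f. bij_betw f {x \<in> A. g x = c} {y \<in> B. h y = c}" for c
    by (rule finite_same_card_bij) (use assms in auto)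
  then obtain F where F: "\<And>c. bij_betw (F c) {x \<in> A. g x = c} {y \<in> B. h y = c}"
    by metis
  define \<Phi> where "\<Phi> x = F (g x) x" for x
  have \<Phi>: "\<Phi> x \<in> B" "h (\<Phi> x) = g x" if "x \<in> A" for x
    using bij_betwE[OF F[of "g x"]] that by (auto simp: \<Phi>_def)
  have "inj_on \<Phi> A"
  proof (rule inj_onI)
    fix x y assume xy: "x \<in> A" "y \<in> A" "\<Phi> x = \<Phi> y"
    then have "g x = g y" using \<Phi>(2) by metis
    then show "x = y"
      using xy bij_betw_imp_inj_on[OF F[of "g x"]] by (auto simp: \<Phi>_def inj_on_def)
  qed
  moreover have "y \<in> \<Phi> ` A" if "y \<in> B" for y
  proof -
    have "y \<in> F (h y) ` {x \<in> A. g x = h y}"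
      using bij_betw_imp_surj_on[OF F[of "h y"]] that by simp
    then obtain x where "x \<in> A" "g x = h y" "y = F (h y) x" by blast
    then show ?thesis by (intro image_eqI[of _ _ x]) (simp_all add: \<Phi>_def)
  qed
  ultimately show ?thesis using \<Phi> unfolding bij_betw_def by blast
qed

theorem theorem2p3:
  fixes n :: nat
  shows "\<exists>\<Phi> :: (nat \<Rightarrow> nat) \<Rightarrow> letter list.
           bij_betw \<Phi> (involutions_avoiding_132 n) {w \<in> primitive_dyck_words. length w = n} \<and>
           (\<forall>\<pi>\<in>involutions_avoiding_132 n.
              int (card (fixed_points n \<pi>)) =
              int (count_list (\<Phi> \<pi>) X) - int (count_list (\<Phi> \<pi>) Xbar))"
proof -
  let ?A = "involutions_avoiding_132 n" and ?B = "{w \<in> primitive_dyck_words. length w = n}"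
  have "card {w \<in> ?B. count_list w Xbar = c} = card (stack_seqs (n - c) c)" for c
  proof (cases "c \<le> n")
    case True
    then have "{w \<in> ?B. count_list w Xbar = c} = ballot_words (n - c) c"
      by (auto simp: ballot_words_def length_eq_counts)
    then show ?thesis by (simp add: card_ballot_words)
  next
    \<comment> \<open>Both sides vanish: the truncated \<open>n - c\<close> is 0, which is less than
      \<open>c\<close>.\<close>
    case False
    then have "{w \<in> ?B. count_list w Xbar = c} = {}" by (auto simp: length_eq_counts)
    then show ?thesis using False by (simp add: stack_seqs_empty del: Collect_empty_eq)
  qed
  then have "card {\<pi> \<in> ?A. card (excedances n \<pi>) = c} = card {w \<in> ?B. count_list w Xbar = c}" for c
    using card_avoiders[of n c] by (simp add: avoiders_def)
  moreover have "finite ?B"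
  proof (rule finite_subset)
    show "?B \<subseteq> {w. set w \<subseteq> {X, Xbar} \<and> length w = n}" using letter.exhaust by auto
  qed (rule finite_lists_length_eq, simp)
  ultimately obtain \<Phi> where \<Phi>: "bij_betw \<Phi> ?A ?B"
    "\<And>\<pi>. \<pi> \<in> ?A \<Longrightarrow> count_list (\<Phi> \<pi>) Xbar = card (excedances n \<pi>)"
    using ex_bij_betw_fibrewise[OF finite_involutions_avoiding_132[of n],
        where B = ?B and g = "\<lambda>\<pi>. card (excedances n \<pi>)" and h = "\<lambda>w. count_list w Xbar"]
    by blast
  have "int (card (fixed_points n \<pi>)) =
      int (count_list (\<Phi> \<pi>) X) - int (count_list (\<Phi> \<pi>) Xbar)" if "\<pi> \<in> ?A" for \<pi>
  proof -
    have "\<Phi> \<pi> \<in> ?B" using bij_betwE[OF \<Phi>(1)] that by blast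
    then have "count_list (\<Phi> \<pi>) X + count_list (\<Phi> \<pi>) Xbar = n"
      using length_eq_counts[of "\<Phi> \<pi>"] by simp
    moreover have "card (fixed_points n \<pi>) + 2 * card (excedances n \<pi>) = n"
      using that by (intro card_fixed_points) (simp add: involutions_avoiding_132_def)
    \<comment> \<open>Both sides equal \<open>n\<close> minus twice the common value of the number
      of \<open>Xbar\<close> and the number of excedances.\<close>
    ultimately show ?thesis using \<Phi>(2)[OF that] by linarith
  qed
  with \<Phi>(1) show ?thesis by blast
qed

end
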